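(* Let $N\ge1$, $p>2$, and $\delta\ge\max\{1,\frac{(p-1)^2}{4}\}$. Set $$l=\frac{2\delta}{p-1}-\frac{p-1}{2},\qquad k=\frac{\delta+p-1+2l}{\delta+p-1},$$ and for $R>0$ let $Q_R=\|w\|^k_{L^k(B_{2R}(0))}=\int_{B_{2R}(0)}w(x)^k\,dx$. Let $w\in C^1(\mathbb{R}^N)$ be a positive function with $w(x)>C$ for all $x$, for some constant $C>0$, and suppose $Q_R=\mathcal{O}(R^\tau)$ (as $R\to\infty$) for some $0<\tau<pk$. Then for every $0<\zeta<1$ there is no positive stable weak solution $u\in C^{1,\zeta}_{loc}(\mathbb{R}^N)$ of $$-\operatorname{div}\big(w(x)|\nabla u|^{p-2}\nabla u\big)=-u^{-\delta}\quad\text{in }\mathbb{R}^N.$$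
   Context: A function $u\in C^{1,\zeta}_{loc}(\mathbb{R}^N)$ is a weak solution of $-\operatorname{div}(w|\nabla u|^{p-2}\nabla u)=f(u)$ in $\mathbb{R}^N$ if $\int_{\mathbb{R}^N} w|\nabla u|^{p-2}\nabla u\cdot\nabla\varphi\,dx-\int_{\mathbb{R}^N} f(u)\varphi\,dx=0$ for all $\varphi\in C^1_c(\mathbb{R}^N)$. Such a weak solution is stable if for all $\varphi\in C^1_c(\mathbb{R}^N)$, $$\int_{\mathbb{R}^N} w|\nabla u|^{p-2}|\nabla\varphi|^2dx+(p-2)\int_{\mathbb{R}^N} w|\nabla u|^{p-4}(\nabla u\cdot\nabla\varphi)^2dx-\int_{\mathbb{R}^N} f'(u)\varphi^2dx\ge 0.$$ Here $f(u)=-u^{-\delta}$ for $u>0$, so $f'(u)=\delta u^{-\delta-1}$. $B_r(0)$ is the open ball of radius $r$ centered at the origin. *)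

theory Defs
  imports "HOL-Analysis.Analysis" "HOL-Library.Landau_Symbols"
begin

definition grad :: "('a::euclidean_space \<Rightarrow> real) \<Rightarrow> 'a \<Rightarrow> 'a" where
  "grad u x = (SOME g. (u has_derivative (\<lambda>h. g \<bullet> h)) (at x))"

definition C1 :: "('a::euclidean_space \<Rightarrow> real) \<Rightarrow> bool" where
  "C1 u \<longleftrightarrow> (\<exists>G. (\<forall>x. (u has_derivative (\<lambda>h. G x \<bullet> h)) (at x)) \<and> continuous_on UNIV G)"

definition C1_holder_loc :: "real \<Rightarrow> ('a::euclidean_space \<Rightarrow> real) \<Rightarrow> bool" where
  "C1_holder_loc \<zeta> u \<longleftrightarrow> (\<exists>G. (\<forall>x. (u has_derivative (\<lambda>h. G x \<bullet> h)) (at x)) \<and>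
      continuous_on UNIV G \<and>
      (\<forall>K. compact K \<longrightarrow> (\<exists>L. \<forall>x\<in>K. \<forall>y\<in>K. norm (G x - G y) \<le> L * dist x y powr \<zeta>)))"

definition C1c :: "('a::euclidean_space \<Rightarrow> real) \<Rightarrow> bool" where
  "C1c \<phi> \<longleftrightarrow> C1 \<phi> \<and> compact (closure {x. \<phi> x \<noteq> 0})"

definition weak_solution ::
  "('a::euclidean_space \<Rightarrow> real) \<Rightarrow> real \<Rightarrow> real \<Rightarrow> ('a \<Rightarrow> real) \<Rightarrow> bool" where
  "weak_solution w p \<delta> u \<longleftrightarrow> (\<forall>\<phi>. C1c \<phi> \<longrightarrow>
     integral UNIV (\<lambda>x. w x * norm (grad u x) powr (p - 2) * (grad u x \<bullet> grad \<phi> x))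
     - integral UNIV (\<lambda>x. (- (u x powr (- \<delta>))) * \<phi> x) = 0)"

text \<open>Stability, with f'(u) = \<delta> u^(-\<delta>-1).  Note: where \<nabla>u = 0 the factor
  |\<nabla>u|^(p-4) is read via powr, i.e. the integrand is 0 there.\<close>
definition stable ::
  "('a::euclidean_space \<Rightarrow> real) \<Rightarrow> real \<Rightarrow> real \<Rightarrow> ('a \<Rightarrow> real) \<Rightarrow> bool" where
  "stable w p \<delta> u \<longleftrightarrow> (\<forall>\<phi>. C1c \<phi> \<longrightarrow>
     integral UNIV (\<lambda>x. w x * norm (grad u x) powr (p - 2) * (norm (grad \<phi> x))\<^sup>2)
     + (p - 2) * integral UNIV (\<lambda>x. w x * norm (grad u x) powr (p - 4) * (grad u x \<bullet> grad \<phi> x)\<^sup>2)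
     - integral UNIV (\<lambda>x. \<delta> * u x powr (- \<delta> - 1) * (\<phi> x)\<^sup>2) \<ge> 0)"

definition exp_l :: "real \<Rightarrow> real \<Rightarrow> real" where
  "exp_l p \<delta> = 2 * \<delta> / (p - 1) - (p - 1) / 2"

definition exp_k :: "real \<Rightarrow> real \<Rightarrow> real" where
  "exp_k p \<delta> = (\<delta> + p - 1 + 2 * exp_l p \<delta>) / (\<delta> + p - 1)"

end

theory Submission
  imports Defs
begin

text \<open>Put $a = 4\delta/(p-1)$ and let $s$ be a Lipschitz cutoff at scale $R$. Testing the equation with
  $u^{-a}s^{4m}$ bounds $a\int w|\nabla u|^p u^{-a-1}s^{4m}$ by $\int u^{-\delta-a}s^{4m}$, and testing
  stability with $u^{(1-a)/2}s^{2m}$ bounds $a\int u^{-\delta-a}s^{4m}$ by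
  $(a-1)^2\int w|\nabla u|^p u^{-a-1}s^{4m}$, both up to terms containing $\nabla s$. Since
  $a^2 > (a-1)^2$, only the latter terms survive. Each of them is pointwise a weighted geometric mean of
  the two integrands above and of $R^{-pk}w^k$, so it can be absorbed up to a multiple of
  $R^{-pk}\int_{B_{2R}}w^k = O(R^{\tau-pk})$. Hence $\int u^{-\delta-a}s^{4m}\to 0$ as $R\to\infty$,
  although this integral increases with $R$ and is positive.\<close>

section \<open>Gradients, integrability and positivity for continuous functions\<close>

text \<open>The choice made in \<open>grad\<close> is harmless because a derivative has only one
  representing vector.\<close>

lemma has_derivative_imp_grad_eq:
  assumes "(u has_derivative (\<lambda>h. g \<bullet> h)) (at x)"
  shows "grad u x = g"
proof -
  have "(u has_derivative (\<lambda>h. grad u x \<bullet> h)) (at x)"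
    unfolding grad_def by (rule someI[of _ g]) (rule assms)
  then have "(\<lambda>h. grad u x \<bullet> h) = (\<lambda>h. g \<bullet> h)"
    using assms has_derivative_unique by blast
  then show ?thesis
    unfolding fun_eq_iff by (simp add: vector_eq_rdot)
qed

lemma integrable_on_UNIV_continuous_compact_support:
  fixes f :: "'a::euclidean_space \<Rightarrow> real"
  assumes "continuous_on UNIV f" and "\<And>x. r \<le> norm x \<Longrightarrow> f x = 0"
  shows "f integrable_on UNIV"
proof -
  obtain a where a: "cball (0::'a) r \<subseteq> cbox (- a) a"
    using bounded_subset_cbox_symmetric[of "cball (0::'a) r"] by auto
  have "f integrable_on cbox (- a) a"
    using assms(1) continuous_on_subset integrable_continuous by blast
  then show ?thesis
  proof (rule integrable_on_superset)
    fix x assume "x \<notin> cbox (- a) a"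
    then have "x \<notin> cball 0 r" using a by blast
    then show "f x = 0" using assms(2)[of x] by simp
  qed simp
qed

lemma integrable_on_ball_continuous:
  fixes f :: "'a::euclidean_space \<Rightarrow> real"
  assumes "continuous_on UNIV f"
  shows "f integrable_on ball c r"
proof -
  obtain a where a: "ball c r \<subseteq> cbox (- a) a"
    using bounded_subset_cbox_symmetric[of "ball c r"] by auto
  have "f absolutely_integrable_on cbox (- a) a"
    using assms absolutely_integrable_continuous continuous_on_subset by blast
  then have "f absolutely_integrable_on ball c r"
    by (rule set_integrable_subset) (use a in auto)
  then show ?thesis
    by (rule set_lebesgue_integral_eq_integral)
qed

text \<open>A nonnegative continuous function whose integral over a box with nonempty interior is 0
  vanishes on that box. Applied to a box around \<open>z\<close>, this gives a positive lower bound
  for the whole integral.\<close>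

lemma integral_UNIV_pos_continuous:
  fixes f :: "'a::euclidean_space \<Rightarrow> real"
  assumes cont: "continuous_on UNIV f" and int: "f integrable_on UNIV"
    and nonneg: "\<And>x. 0 \<le> f x" and pos: "0 < f z"
  shows "0 < integral UNIV f"
proof -
  define S where "S = cbox (z - One) (z + One)"
  have z: "z \<in> box (z - One) (z + One)"
    by (simp add: mem_box inner_diff_left inner_add_left)
  have cS: "continuous_on S f" using cont continuous_on_subset by blast
  have iS: "f integrable_on S" using cS unfolding S_def by (rule integrable_continuous)
  have "integral S f \<noteq> 0"
    using integral_cbox_eq_0_iff[of "z - One" "z + One" f] cS nonneg pos z box_subset_cbox
    unfolding S_def by (metis empty_iff less_irrefl subsetD)
  moreover have "0 \<le> integral S f" using iS nonneg by (simp add: integral_nonneg)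
  moreover have "integral S f \<le> integral UNIV f"
    using iS int nonneg by (intro integral_subset_le) auto
  ultimately show ?thesis by linarith
qed

section \<open>The cutoff and the test functions built from it\<close>

text \<open>The positive part has a kink at 0, but its square is continuously differentiable. Even
  exponents reduce to that square by the chain rule, which is why the powers of the cutoff are even
  throughout.\<close>

lemma DERIV_max_0_even_power:
  assumes "1 \<le> (m::nat)"
  shows "((\<lambda>t::real. max 0 t ^ (2 * m)) has_real_derivative
    2 * m * max 0 t ^ (2 * m - 1)) (at t)"
proof -
  have sq: "((\<lambda>t::real. (max 0 t)\<^sup>2) has_real_derivative 2 * max 0 t) (at t)" for t
  proof -
    have bound: "norm (((max 0 (t + h))\<^sup>2 - (max 0 t)\<^sup>2) / h - 2 * max 0 t) \<le> \<bar>h\<bar>"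
      if "h \<noteq> 0" for h :: real
    proof -
      \<comment> \<open>First-order Taylor remainder of a function whose derivative is Lipschitz
        with constant 2. Only a change of sign between \<open>t\<close> and \<open>t + h\<close>
        needs an argument.\<close>
      have 1: "\<bar>(max 0 (t + h))\<^sup>2 - (max 0 t)\<^sup>2 - 2 * max 0 t * h\<bar> \<le> h\<^sup>2"
      proof (cases "0 \<le> t"; cases "0 \<le> t + h")
        assume "\<not> 0 \<le> t" "0 \<le> t + h"
        then have "\<bar>t + h\<bar> \<le> \<bar>h\<bar>" by linarith
        then have "(t + h)\<^sup>2 \<le> h\<^sup>2" by (rule abs_le_square_iff[THEN iffD1])
        with \<open>\<not> 0 \<le> t\<close> \<open>0 \<le> t + h\<close> show ?thesis by (simp add: max_def)
      next
        assume a: "0 \<le> t" "\<not> 0 \<le> t + h"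
        have "0 \<le> (t + h)\<^sup>2" by simp
        moreover have "t * (t + 2 * h) \<le> 0" using a by (intro mult_nonneg_nonpos) auto
        ultimately show ?thesis using a
          by (simp add: max_def power2_eq_square algebra_simps abs_le_iff)
      qed (auto simp: max_def power2_eq_square algebra_simps)
      have "((max 0 (t + h))\<^sup>2 - (max 0 t)\<^sup>2) / h - 2 * max 0 t
          = ((max 0 (t + h))\<^sup>2 - (max 0 t)\<^sup>2 - 2 * max 0 t * h) / h"
        using that by (simp add: field_simps)
      then show ?thesis
        using 1 that by (simp add: abs_mult divide_le_eq power2_eq_square)
    qed
    have "((\<lambda>h. ((max 0 (t + h))\<^sup>2 - (max 0 t)\<^sup>2) / h - 2 * max 0 t) \<longlongrightarrow> 0) (at 0)"
      by (rule Lim_null_comparison[where g = "\<lambda>h. \<bar>h\<bar>"])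
        (use bound in \<open>auto simp: eventually_at_filter intro!: tendsto_eq_intros\<close>)
    then show ?thesis
      unfolding DERIV_def by (rule LIM_zero_cancel)
  qed
  have "((\<lambda>t. ((max 0 t)\<^sup>2) ^ m) has_real_derivative
      m * ((max 0 t)\<^sup>2) ^ (m - 1) * (2 * max 0 t)) (at t)"
    by (rule DERIV_cong[OF DERIV_power[OF sq]]) (simp add: mult_ac)
  moreover have "((max 0 t)\<^sup>2) ^ (m - 1) * max 0 t = max 0 t ^ (2 * m - 1)"
  proof -
    have "2 * m - 1 = Suc (2 * (m - 1))" using assms by simp
    then show ?thesis by (simp add: power_mult)
  qed
  ultimately show ?thesis
    by (simp add: power_mult[symmetric] mult.assoc mult.left_commute)
qed

text \<open>The squared norm keeps the profile smooth at the origin. Inside the ball of radius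
  \<open>2 * R\<close> the gradient is \<open>- x / (2 * R^2)\<close>, of norm at most
  \<open>1 / R\<close>.\<close>

definition cutoff :: "real \<Rightarrow> 'a::euclidean_space \<Rightarrow> real" where
  "cutoff R x = max 0 (1 - (norm x)\<^sup>2 / (4 * R\<^sup>2))"

lemma cutoff_nonneg: "0 \<le> cutoff R x"
  by (simp add: cutoff_def)

lemma cutoff_le_1: "cutoff R x \<le> 1"
  by (simp add: cutoff_def)

lemma cutoff_eq_0:
  assumes "0 < R" and "2 * R \<le> norm x"
  shows "cutoff R x = 0"
proof -
  have "(2 * R)\<^sup>2 \<le> (norm x)\<^sup>2" using assms by (intro power_mono) auto
  then show ?thesis using assms by (simp add: cutoff_def field_simps)
qed

lemma cutoff_mono:
  assumes "0 < R" and "R \<le> R'"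
  shows "cutoff R x \<le> cutoff R' x"
proof -
  have "R\<^sup>2 \<le> R'\<^sup>2" using assms by (intro power_mono) auto
  then have "(norm x)\<^sup>2 / (4 * R'\<^sup>2) \<le> (norm x)\<^sup>2 / (4 * R\<^sup>2)"
    using assms by (intro divide_left_mono) auto
  then show ?thesis by (auto simp: cutoff_def)
qed

lemma continuous_on_cutoff [continuous_intros]: "continuous_on S (cutoff R)"
  \<comment> \<open>For \<open>R = 0\<close> division by zero makes the cutoff constantly 1.\<close>
  unfolding cutoff_def by (cases "R = 0") (auto intro!: continuous_intros)

text \<open>Product rule. The factor \<open>m / R^2\<close> is \<open>2 * m\<close> from the power
  times \<open>1 / (2 * R^2)\<close> from the gradient of the cutoff profile.\<close>

lemma has_derivative_powr_cutoff:
  fixes u :: "'a::euclidean_space \<Rightarrow> real"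
  assumes "(u has_derivative (\<lambda>h. g \<bullet> h)) (at x)" and "0 < u x" and "1 \<le> (m::nat)" and "R > 0"
  shows "((\<lambda>x. u x powr b * cutoff R x ^ (2 * m)) has_derivative
    (\<lambda>h. ((b * u x powr (b - 1) * cutoff R x ^ (2 * m)) *\<^sub>R g
      - (m / R\<^sup>2 * u x powr b * cutoff R x ^ (2 * m - 1)) *\<^sub>R x) \<bullet> h)) (at x)"
proof -
  have n: "((\<lambda>x. 1 - (norm x)\<^sup>2 / (4 * R\<^sup>2)) has_derivative
      (\<lambda>h. - (x \<bullet> h) / (2 * R\<^sup>2))) (at x)"
    unfolding power2_norm_eq_inner using \<open>R > 0\<close>
    by (auto intro!: derivative_eq_intros simp: inner_commute field_simps)
  have c: "((\<lambda>x. cutoff R x ^ (2 * m)) has_derivative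
      (\<lambda>h. - (x \<bullet> h) / (2 * R\<^sup>2) * (2 * m * cutoff R x ^ (2 * m - 1)))) (at x)"
    using has_derivative_compose[OF n DERIV_max_0_even_power[OF \<open>1 \<le> m\<close>,
        unfolded has_field_derivative_def]]
    by (simp add: cutoff_def mult.commute)
  have p: "((\<lambda>x. u x powr b) has_derivative (\<lambda>h. b * u x powr (b - 1) * (g \<bullet> h))) (at x)"
    by (rule has_derivative_eq_rhs[OF has_derivative_powr[OF assms(1) has_derivative_const]])
      (use assms(2) in \<open>auto simp: powr_diff\<close>)
  show ?thesis
    by (rule has_derivative_eq_rhs[OF has_derivative_mult[OF p c]])
      (use \<open>R > 0\<close> in \<open>auto simp: inner_diff_left field_simps\<close>)
qed

text \<open>Makes both test functions of the energy estimate admissible: \<open>b = - a\<close> for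
  the equation and \<open>b = (1 - a) / 2\<close> for stability. Positivity of \<open>u\<close>
  makes its real powers differentiable, and the cutoff confines the support to a closed ball of
  radius \<open>2 * R\<close>.\<close>

lemma C1c_powr_cutoff:
  fixes u :: "'a::euclidean_space \<Rightarrow> real"
  assumes du: "\<And>x. (u has_derivative (\<lambda>h. G x \<bullet> h)) (at x)"
    and cG: "continuous_on UNIV G" and pos: "\<And>x. 0 < u x" and "1 \<le> (m::nat)" and "R > 0"
  shows "C1c (\<lambda>x. u x powr b * cutoff R x ^ (2 * m))"
proof -
  have cu: "continuous_on UNIV u"
    using du by (meson continuous_at_imp_continuous_on has_derivative_continuous)
  have "C1 (\<lambda>x. u x powr b * cutoff R x ^ (2 * m))"
    unfolding C1_def
  proof (intro exI conjI allI)
    show "((\<lambda>x. u x powr b * cutoff R x ^ (2 * m)) has_derivative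
      (\<lambda>h. ((b * u x powr (b - 1) * cutoff R x ^ (2 * m)) *\<^sub>R G x
      - (m / R\<^sup>2 * u x powr b * cutoff R x ^ (2 * m - 1)) *\<^sub>R x) \<bullet> h)) (at x)" for x
      by (rule has_derivative_powr_cutoff[OF du pos assms(4,5)])
    show "continuous_on UNIV (\<lambda>x. (b * u x powr (b - 1) * cutoff R x ^ (2 * m)) *\<^sub>R G x
      - (m / R\<^sup>2 * u x powr b * cutoff R x ^ (2 * m - 1)) *\<^sub>R x)"
      by (intro continuous_intros cu cG) (metis pos less_irrefl)+
  qed
  moreover have "{x. u x powr b * cutoff R x ^ (2 * m) \<noteq> 0} \<subseteq> cball 0 (2 * R)"
    using cutoff_eq_0[OF \<open>R > 0\<close>] \<open>1 \<le> m\<close> by (force simp: power_0_left)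
  then have "compact (closure {x. u x powr b * cutoff R x ^ (2 * m) \<noteq> 0})"
    using bounded_cball bounded_subset compact_closure by blast
  ultimately show ?thesis by (simp add: C1c_def)
qed

lemma C1_continuous_on_grad:
  assumes "C1 \<phi>"
  shows "continuous_on UNIV (grad \<phi>)"
proof -
  obtain G where "\<And>x. (\<phi> has_derivative (\<lambda>h. G x \<bullet> h)) (at x)" and "continuous_on UNIV G"
    using assms unfolding C1_def by blast
  moreover from this(1) have "grad \<phi> = G"
    using has_derivative_imp_grad_eq by blast
  ultimately show ?thesis by simp
qed

section \<open>Absorbing the terms that contain the gradient of the cutoff\<close>

text \<open>Young's inequality with a small coefficient on \<open>M\<close>. With \<open>c\<close>
  chosen so that \<open>c powr \<theta> = \<epsilon>\<close>, the first summand alone suffices if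
  \<open>B \<le> c * M\<close>, and the second one otherwise.\<close>

lemma powr_interpolation:
  fixes \<theta> \<epsilon> :: real
  assumes "0 < \<theta>" and "\<theta> < 1" and "0 < \<epsilon>"
  obtains C where "0 \<le> C"
    and "\<And>M B. 0 \<le> M \<Longrightarrow> 0 \<le> B \<Longrightarrow> M powr (1 - \<theta>) * B powr \<theta> \<le> \<epsilon> * M + C * B"
proof -
  define c where "c = \<epsilon> powr (1 / \<theta>)"
  have c: "0 < c" "c powr \<theta> = \<epsilon>" using assms by (auto simp: c_def powr_powr)
  define C where "C = (1 / c) powr (1 - \<theta>)"
  have C: "0 \<le> C" by (simp add: C_def)
  have "M powr (1 - \<theta>) * B powr \<theta> \<le> \<epsilon> * M + C * B" if "0 \<le> M" "0 \<le> B" for M B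
  proof (cases "B \<le> c * M")
    case True
    then have "M powr (1 - \<theta>) * B powr \<theta> \<le> M powr (1 - \<theta>) * (c * M) powr \<theta>"
      using that assms by (intro mult_left_mono powr_mono2) auto
    also have "\<dots> = \<epsilon> * (M powr (1 - \<theta>) * M powr \<theta>)"
      using that c by (simp add: powr_mult)
    also have "\<dots> = \<epsilon> * M"
      using that by (simp add: powr_add[symmetric])
    finally show ?thesis using C that by (simp add: add_increasing2)
  next
    case False
    then have "M \<le> 1 / c * B" using c by (simp add: field_simps)
    then have "M powr (1 - \<theta>) * B powr \<theta> \<le> (1 / c * B) powr (1 - \<theta>) * B powr \<theta>"
      using that assms by (intro mult_right_mono powr_mono2) auto
    also have "\<dots> = C * (B powr (1 - \<theta>) * B powr \<theta>)"
      using that c by (simp add: powr_mult powr_divide C_def)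
    also have "\<dots> = C * B"
      using that by (simp add: powr_add[symmetric])
    finally show ?thesis using that assms by (simp add: add_increasing)
  qed
  with C show thesis by (rule that)
qed

text \<open>With P and X the two integrands on the right,
  \<open>B = w powr k * R powr (- (p * k))\<close> and \<open>\<theta> = j / (p * k)\<close>, the
  left side equals P^(1 - j/p) X^(j/p - \<theta>) (B s^(N - p k))^\<theta> when no factor vanishes.
  The relation between \<open>a\<close> and \<open>k\<close> is exactly what matches the powers of
  \<open>u\<close>, and \<open>1 \<le> k\<close> makes the exponent of X nonnegative. The cases
  \<open>j = 1\<close> and \<open>j = 2\<close> cover all error terms, and \<open>C\<close> depends
  neither on the point nor on \<open>R\<close>.\<close>

lemma mixed_term_bound:
  fixes p \<delta> a k \<epsilon> :: real and j N :: nat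
  assumes "2 < p" and "1 \<le> k" and k: "\<delta> + a = (\<delta> + p - 1) * k" and "1 \<le> j" and "j \<le> 2"
    and "0 < \<epsilon>" and N: "p * k \<le> N"
  obtains C where "0 \<le> C"
    and "\<And>w g u s R. 0 < w \<Longrightarrow> 0 \<le> g \<Longrightarrow> 0 < u \<Longrightarrow> 0 \<le> s \<Longrightarrow> s \<le> 1 \<Longrightarrow> 0 < R \<Longrightarrow>
      w * g powr (p - j) * u powr (real j - 1 - a) * s ^ (N - j) / R ^ j
      \<le> \<epsilon> * (w * g powr p * u powr (- a - 1) * s ^ N + u powr (- \<delta> - a) * s ^ N)
        + C * (w powr k * R powr (- (p * k)))"
proof -
  define \<theta> where "\<theta> = j / (p * k)"
  have "p * 1 \<le> p * k" using assms by (intro mult_left_mono) auto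
  moreover have "real j < p" using assms by linarith
  ultimately have pk: "j < p" "j < p * k" "2 < p * k" "p \<le> p * k"
    using \<open>2 < p\<close> by linarith+
  have \<theta>: "0 < \<theta>" "\<theta> < 1" "\<theta> \<le> j / p"
    using pk(2,3) \<open>1 \<le> j\<close> frac_le[of j j p "p * k"] pk(4) \<open>2 < p\<close> unfolding \<theta>_def
    by (simp_all add: divide_less_eq_1 del: mult_le_cancel_left1)
  have jN: "j < N" using pk N by linarith
  obtain C where C: "0 \<le> C"
    "\<And>M B. 0 \<le> M \<Longrightarrow> 0 \<le> B \<Longrightarrow> M powr (1 - \<theta>) * B powr \<theta> \<le> \<epsilon> * M + C * B"
    using powr_interpolation[OF \<theta>(1,2) \<open>0 < \<epsilon>\<close>] by blast
  show thesis
  proof (rule that[OF C(1)])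
    fix w g u s R :: real
    assume pos: "0 < w" "0 \<le> g" "0 < u" "0 \<le> s" "s \<le> 1" "0 < R"
    define P where "P = w * g powr p * u powr (- a - 1) * s ^ N"
    define X where "X = u powr (- \<delta> - a) * s ^ N"
    define B where "B = w powr k * R powr (- (p * k))"
    have nn: "0 \<le> P" "0 \<le> X" "0 \<le> B" using pos by (auto simp: P_def X_def B_def)
    show "w * g powr (p - j) * u powr (real j - 1 - a) * s ^ (N - j) / R ^ j
      \<le> \<epsilon> * (w * g powr p * u powr (- a - 1) * s ^ N + u powr (- \<delta> - a) * s ^ N)
        + C * (w powr k * R powr (- (p * k)))"
      unfolding P_def[symmetric] X_def[symmetric] B_def[symmetric]
    proof (cases "g = 0 \<or> s = 0")
      case True
      then have "w * g powr (p - j) * u powr (real j - 1 - a) * s ^ (N - j) / R ^ j = 0"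
        using jN by (auto simp: power_0_left)
      then show "w * g powr (p - j) * u powr (real j - 1 - a) * s ^ (N - j) / R ^ j \<le> \<epsilon> * (P + X) + C * B"
        using nn C(1) \<open>0 < \<epsilon>\<close> by (simp only:) simp
    next
      case False
      \<comment> \<open>All five quantities are positive here, so logarithms turn the factorization
        into an identity between exponents.\<close>
      define W H U S T where "W = ln w" and "H = ln g" and "U = ln u" and "S = ln s" and "T = ln R"
      have e: "w = exp W" "g = exp H" "u = exp U" "s = exp S" "R = exp T"
        using pos False by (auto simp: W_def H_def U_def S_def T_def)
      have "w * g powr (p - j) * u powr (real j - 1 - a) * s ^ (N - j) / R ^ j
        = P powr (1 - j / p) * X powr (j / p - \<theta>) * (B * s powr (N - p * k)) powr \<theta>"
      proof -
        have \<theta>k: "\<theta> * k = j / p" "\<theta> * (p * k) = j"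
          using assms pk by (auto simp: \<theta>_def)
        \<comment> \<open>Multiplying the relation between \<open>a\<close> and \<open>k\<close> by
          \<open>\<theta>\<close> eliminates \<open>k\<close>, since
          \<open>\<theta> * k = j / p\<close>. This is the matching of the powers of
          \<open>u\<close>.\<close>
        have "a * \<theta> + \<delta> * \<theta> = (\<delta> + p - 1) * (\<theta> * k)"
          using arg_cong[OF k, of "\<lambda>t. t * \<theta>"] by (simp add: algebra_simps)
        then have a\<theta>: "a * \<theta> = (\<delta> + p - 1) * j / p - \<delta> * \<theta>" by (simp add: \<theta>k)
        have "W + (p - j) * H + (real j - 1 - a) * U + (real N - real j) * S - j * T
          = (W + p * H + (- a - 1) * U + N * S) * (1 - j / p)
            + ((- \<delta> - a) * U + N * S) * (j / p - \<theta>)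
            + (k * W - p * k * T + (N - p * k) * S) * \<theta>"
        proof -
          have "W = W * (1 - j / p) + W * (\<theta> * k)" by (simp add: \<theta>k algebra_simps)
          moreover have "(p - j) * H = p * H * (1 - j / p)"
            using assms by (simp add: field_simps)
          moreover have "(real j - 1 - a) * U = (- a - 1) * U * (1 - j / p) + (- \<delta> - a) * U * (j / p - \<theta>)"
          proof -
            have "real j - 1 - a = (- a - 1) * (1 - j / p) + (- \<delta> - a) * (j / p) + \<delta> * \<theta> + a * \<theta>"
              unfolding a\<theta> using assms by (simp add: field_simps)
            also have "\<dots> = (- a - 1) * (1 - j / p) + (- \<delta> - a) * (j / p - \<theta>)"
              by (simp add: algebra_simps)
            finally have c: "real j - 1 - a = \<dots>" .
            have "(x * y + z * v) * U = x * U * y + z * U * v" for x y z v :: real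
              by (simp add: algebra_simps)
            then show ?thesis unfolding c .
          qed
          moreover have "(real N - real j) * S = N * S * (1 - j / p) + N * S * (j / p - \<theta>) + (N - p * k) * S * \<theta>"
            unfolding \<theta>k(2)[symmetric] by (simp add: algebra_simps)
          moreover have "j * T = p * k * T * \<theta>"
            unfolding \<theta>k(2)[symmetric] by (simp add: algebra_simps)
          ultimately show ?thesis by (simp only: distrib_right left_diff_distrib) (simp only: algebra_simps)
        qed
        moreover have "w * g powr (p - j) * u powr (real j - 1 - a) * s ^ (N - j) / R ^ j
          = exp (W + (p - j) * H + (real j - 1 - a) * U + (real N - real j) * S - j * T)"
        proof -
          \<comment> \<open>\<open>j < N\<close> ensures that the subtraction of naturals does not
            truncate.\<close>
          have N: "real N - real j = of_nat (N - j)" using jN by simp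
          show ?thesis unfolding e N
            by (simp only: exp_powr_real exp_add exp_diff exp_of_nat_mult mult.commute[of _ H] mult.commute[of _ U])
        qed
        moreover have "P = exp (W + p * H + (- a - 1) * U + N * S)"
          unfolding P_def e by (simp only: exp_powr_real exp_add exp_of_nat_mult mult.commute[of _ H] mult.commute[of _ U])
        moreover have "X = exp ((- \<delta> - a) * U + N * S)"
          unfolding X_def e by (simp only: exp_powr_real exp_add exp_of_nat_mult mult.commute[of _ U])
        moreover have "B * s powr (N - p * k) = exp (k * W - p * k * T + (N - p * k) * S)"
          unfolding B_def e by (simp add: exp_powr_real mult_exp_exp mult_ac)
        ultimately show ?thesis
          by (simp only: exp_powr_real mult_exp_exp)
      qed
      \<comment> \<open>Enlarging P and X to \<open>P + X\<close> lets their exponents add up to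
        \<open>1 - \<theta>\<close>. The leftover power of \<open>s\<close> is at most 1 because
        \<open>p * k \<le> N\<close>.\<close>
      also have "\<dots> \<le> (P + X) powr (1 - j / p) * (P + X) powr (j / p - \<theta>) * B powr \<theta>"
      proof -
        have "s powr (N - p * k) \<le> 1" using pos N by (intro powr_le1) auto
        then have "B * s powr (N - p * k) \<le> B" using nn by (simp add: mult_left_le)
        then show ?thesis
          using nn \<theta> pk assms pos by (intro mult_mono powr_mono2) auto
      qed
      also have "\<dots> = (P + X) powr (1 - \<theta>) * B powr \<theta>"
        by (simp add: powr_add[symmetric])
      also have "\<dots> \<le> \<epsilon> * (P + X) + C * B"
        using C(2) nn by simp
      finally show "w * g powr (p - j) * u powr (real j - 1 - a) * s ^ (N - j) / R ^ j \<le> \<epsilon> * (P + X) + C * B" .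
    qed
  qed
qed

section \<open>Pointwise bounds for the tested integrands\<close>

text \<open>The vector paired with \<open>g\<close> is the gradient of the test function u^(-a)
  s^(4m). Its first part produces the main term exactly. The second is bounded by Cauchy-Schwarz,
  where \<open>norm x \<le> 2 * R\<close> turns \<open>2 * m / R^2\<close> into
  \<open>4 * m / R\<close>.\<close>

lemma weak_integrand_le:
  fixes g x :: "'a::euclidean_space" and w u s R p a :: real and m :: nat
  assumes "0 < w" and "0 < u" and "0 \<le> s" and "0 < R" and "2 < p"
    and x: "s \<noteq> 0 \<Longrightarrow> norm x \<le> 2 * R" and "1 \<le> m"
  shows "w * norm g powr (p - 2) *
      (g \<bullet> ((- a * u powr (- a - 1) * s ^ (4 * m)) *\<^sub>R g
        - (2 * m / R\<^sup>2 * u powr - a * s ^ (4 * m - 1)) *\<^sub>R x))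
    \<le> - a * (w * norm g powr p * u powr (- a - 1) * s ^ (4 * m))
      + 4 * m * (w * norm g powr (p - 1) * u powr - a * s ^ (4 * m - 1) / R)"
proof -
  define n where "n = norm g"
  \<comment> \<open>At \<open>n = 0\<close> both sides are 0, because \<open>0 powr b = 0\<close>
    for every \<open>b\<close>.\<close>
  have n: "n powr (p - 2) * n\<^sup>2 = n powr p" "n powr (p - 2) * n = n powr (p - 1)"
    by (cases "n = 0"; simp add: n_def powr_diff field_simps power2_eq_square)+
  \<comment> \<open>The bound on \<open>norm x\<close> is available only where \<open>s\<close> is
    nonzero; elsewhere the positive power of \<open>s\<close> kills both sides.\<close>
  have "- (s ^ (4 * m - 1) * (g \<bullet> x)) \<le> s ^ (4 * m - 1) * (n * (2 * R))"
  proof (cases "s = 0")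
    case True
    then show ?thesis using \<open>1 \<le> m\<close> by (simp add: power_0_left)
  next
    case False
    have "- (g \<bullet> x) \<le> n * norm x"
      unfolding n_def using Cauchy_Schwarz_ineq2[of g x] by linarith
    also have "\<dots> \<le> n * (2 * R)" using x[OF False] by (simp add: n_def mult_left_mono)
    finally show ?thesis
      using mult_left_mono[of "- (g \<bullet> x)" _ "s ^ (4 * m - 1)"] \<open>0 \<le> s\<close> by simp
  qed
  then have "w * n powr (p - 2) * (2 * m / R\<^sup>2) * u powr - a * - (s ^ (4 * m - 1) * (g \<bullet> x))
      \<le> w * n powr (p - 2) * (2 * m / R\<^sup>2) * u powr - a * (s ^ (4 * m - 1) * (n * (2 * R)))"
    using assms by (intro mult_left_mono) auto
  also have "\<dots> = 4 * m * (w * (n powr (p - 2) * n) * u powr - a * s ^ (4 * m - 1) / R)"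
    using \<open>0 < R\<close> by (simp add: power2_eq_square)
  finally have 1: "w * n powr (p - 2) * (2 * m / R\<^sup>2) * u powr - a * - (s ^ (4 * m - 1) * (g \<bullet> x)) \<le> \<dots>" .
  have "w * n powr (p - 2) *
      (g \<bullet> ((- a * u powr (- a - 1) * s ^ (4 * m)) *\<^sub>R g
        - (2 * m / R\<^sup>2 * u powr - a * s ^ (4 * m - 1)) *\<^sub>R x))
    = - a * (w * (n powr (p - 2) * n\<^sup>2) * u powr (- a - 1) * s ^ (4 * m))
      + w * n powr (p - 2) * (2 * m / R\<^sup>2) * u powr - a * - (s ^ (4 * m - 1) * (g \<bullet> x))"
    unfolding inner_diff_right inner_scaleR_right dot_square_norm n_def[symmetric]
    by (simp add: algebra_simps)
  with 1 show ?thesis by (simp add: n n_def[symmetric])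
qed

text \<open>The triangle inequality bounds the gradient of u^((1-a)/2) s^(2m) by a sum of two
  nonnegative terms, \<open>1 \<le> a\<close> giving the sign of the first. The right side is the
  expanded square of that sum; its last two terms are the cases \<open>j = 1\<close> and
  \<open>j = 2\<close> of \<open>mixed_term_bound\<close>.\<close>

lemma stable_integrand_le:
  fixes g x :: "'a::euclidean_space" and w u s R p a :: real and m :: nat
  assumes "0 < w" and "0 < u" and "0 \<le> s" and "0 < R" and "2 < p" and "1 \<le> a"
    and x: "s \<noteq> 0 \<Longrightarrow> norm x \<le> 2 * R" and "1 \<le> m"
  shows "w * norm g powr (p - 2) *
      (norm (((1 - a) / 2 * u powr ((1 - a) / 2 - 1) * s ^ (2 * m)) *\<^sub>R g
        - (m / R\<^sup>2 * u powr ((1 - a) / 2) * s ^ (2 * m - 1)) *\<^sub>R x))\<^sup>2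
    \<le> (a - 1)\<^sup>2 / 4 * (w * norm g powr p * u powr (- a - 1) * s ^ (4 * m))
      + (a - 1) * (2 * real m) * (w * norm g powr (p - 1) * u powr - a * s ^ (4 * m - 1) / R)
      + (2 * real m)\<^sup>2 * (w * norm g powr (p - 2) * u powr (1 - a) * s ^ (4 * m - 2) / R\<^sup>2)"
proof -
  define n where "n = norm g"
  have n: "n powr (p - 2) * n\<^sup>2 = n powr p" "n powr (p - 2) * n = n powr (p - 1)"
    by (cases "n = 0"; simp add: n_def powr_diff field_simps power2_eq_square)+
  define v where "v = u powr ((1 - a) / 2)"
  have v: "0 < v" "u powr ((1 - a) / 2 - 1) = v / u" "v * v = u powr (1 - a)"
    using \<open>0 < u\<close> by (simp_all add: v_def powr_diff powr_add[symmetric])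
  have u: "u powr - a = v * v / u" "u powr (- a - 1) = v * v / (u * u)"
    using \<open>0 < u\<close> unfolding v(3) by (simp_all add: powr_diff powr_minus field_simps)
  \<comment> \<open>\<open>q\<close> stands for \<open>2 * m - 1\<close>, so that no subtraction of
    naturals remains in the exponents.\<close>
  obtain q where q: "2 * m = Suc q" using \<open>1 \<le> m\<close> by (metis Suc_le_D mult_eq_0_iff not_one_le_zero not0_implies_Suc zero_neq_numeral)
  have m4: "4 * m = Suc (Suc (q + q))" using q by simp
  have sx: "s ^ q * norm x \<le> s ^ q * (2 * R)"
  proof (cases "s = 0")
    case True
    have "q \<noteq> 0" using q by presburger
    with True show ?thesis by (simp add: power_0_left)
  next
    case False
    then show ?thesis using x \<open>0 \<le> s\<close> by (intro mult_left_mono) auto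
  qed
  have "norm (((1 - a) / 2 * (v / u) * s ^ Suc q) *\<^sub>R g - (m / R\<^sup>2 * v * s ^ q) *\<^sub>R x)
      \<le> (a - 1) / 2 * (v / u) * s ^ Suc q * n + m / R\<^sup>2 * v * (s ^ q * norm x)"
    using norm_triangle_ineq4[of "((1 - a) / 2 * (v / u) * s ^ Suc q) *\<^sub>R g" "(m / R\<^sup>2 * v * s ^ q) *\<^sub>R x"]
      assms(2,3,6) v(1) unfolding n_def by (simp add: abs_mult mult_ac)
  also have "\<dots> \<le> (a - 1) / 2 * (v / u) * s ^ Suc q * n + m / R\<^sup>2 * v * (s ^ q * (2 * R))"
    using sx v(1) by (intro add_left_mono mult_left_mono[OF sx]) auto
  also have "\<dots> = (a - 1) / 2 * (v / u) * s ^ Suc q * n + 2 * m * v * s ^ q / R"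
    using \<open>0 < R\<close> by (simp add: power2_eq_square)
  finally have "w * n powr (p - 2) *
      (norm (((1 - a) / 2 * (v / u) * s ^ Suc q) *\<^sub>R g - (m / R\<^sup>2 * v * s ^ q) *\<^sub>R x))\<^sup>2
    \<le> w * n powr (p - 2) * ((a - 1) / 2 * (v / u) * s ^ Suc q * n + 2 * m * v * s ^ q / R)\<^sup>2"
    using assms by (intro mult_left_mono power_mono) auto
  also have "\<dots> = (a - 1)\<^sup>2 / 4 * (w * (n powr (p - 2) * n\<^sup>2) * (v * v / (u * u)) * s ^ (4 * m))
      + (a - 1) * (2 * real m) * (w * (n powr (p - 2) * n) * (v * v / u) * s ^ (4 * m - 1) / R)
      + (2 * real m)\<^sup>2 * (w * n powr (p - 2) * (v * v) * s ^ (4 * m - 2) / R\<^sup>2)"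
    unfolding m4 using \<open>0 < u\<close> \<open>0 < R\<close>
    by (simp add: power2_eq_square power_add field_simps)
  finally show ?thesis
    unfolding n n_def[symmetric] v_def[symmetric] v u q by simp
qed

section \<open>The energy estimate, uniform in the radius\<close>

text \<open>The relation \<open>4 * \<delta> = a * (p - 1)\<close> fits the factor
  \<open>p - 1\<close> that stability produces once its second integral is bounded by its first.
  \<open>K\<close> is fixed before \<open>R\<close>, so the whole dependence on the radius sits in
  the weighted integral of \<open>w powr k\<close>.\<close>

lemma energy_estimate:
  fixes w u :: "'a::euclidean_space \<Rightarrow> real" and G :: "'a \<Rightarrow> 'a"
    and p a \<delta> k :: real and m :: nat
  assumes p: "2 < p" and a: "1 \<le> a" and a\<delta>: "4 * \<delta> = a * (p - 1)"
    and k: "\<delta> + a = (\<delta> + p - 1) * k" "1 \<le> k" and m: "p * k \<le> 4 * m"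
    and cw: "continuous_on UNIV w" and w: "\<And>x. 0 < w x" and u: "\<And>x. 0 < u x"
    and du: "\<And>x. (u has_derivative (\<lambda>h. G x \<bullet> h)) (at x)" and cG: "continuous_on UNIV G"
    and weak: "weak_solution w p \<delta> u" and stab: "stable w p \<delta> u"
  obtains K where "\<And>R. 0 < R \<Longrightarrow>
    integral UNIV (\<lambda>x. u x powr (- \<delta> - a) * cutoff R x ^ (4 * m))
    \<le> K * (R powr (- (p * k)) * integral (ball 0 (2 * R)) (\<lambda>x. w x powr k))"
proof -
  have "p * 1 \<le> p * k" using k(2) p by (intro mult_left_mono) auto
  with p have "0 < p * k" by linarith
  then have "m \<noteq> 0" using m by (intro notI) simp
  then have m1: "1 \<le> m" "1 \<le> 2 * m" by auto
  have gu: "grad u x = G x" for x by (rule has_derivative_imp_grad_eq[OF du])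
  have cu: "continuous_on UNIV u"
    using du by (meson continuous_at_imp_continuous_on has_derivative_continuous)
  \<comment> \<open>\<open>L\<close> collects the coefficients of the error \<open>Y\<close> when
    the two tested inequalities are combined, and \<open>\<epsilon>\<close> solves
    \<open>\<epsilon> * (2 * L + 2 * n) = 1 / 2\<close>, so that half of \<open>Y\<close> can be
    absorbed.\<close>
  define n L \<epsilon> :: real where "n = 2 * real m" and "L = (a - 1)\<^sup>2 * (2 * n) + 4 * ((a - 1) * n + n\<^sup>2) * a"
    and "\<epsilon> = 1 / (2 * (2 * L + 2 * n))"
  have n: "1 \<le> n" using m1 by (simp add: n_def)
  have L: "0 \<le> L" using n a by (simp add: L_def)
  have \<epsilon>: "0 < \<epsilon>" using n L by (simp add: \<epsilon>_def)
  have pkN: "p * k \<le> real (4 * m)" using m by simp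
  obtain C1 where C1: "0 \<le> C1" "\<And>w g u s R. 0 < w \<Longrightarrow> 0 \<le> g \<Longrightarrow> 0 < u \<Longrightarrow> 0 \<le> s \<Longrightarrow> s \<le> 1 \<Longrightarrow> 0 < R \<Longrightarrow>
      w * g powr (p - 1) * u powr - a * s ^ (4 * m - 1) / R
      \<le> \<epsilon> * (w * g powr p * u powr (- a - 1) * s ^ (4 * m) + u powr (- \<delta> - a) * s ^ (4 * m))
        + C1 * (w powr k * R powr (- (p * k)))"
    by (rule mixed_term_bound[OF p k(2,1) _ _ \<epsilon> pkN, of 1]) auto
  obtain C2 where C2: "0 \<le> C2" "\<And>w g u s R. 0 < w \<Longrightarrow> 0 \<le> g \<Longrightarrow> 0 < u \<Longrightarrow> 0 \<le> s \<Longrightarrow> s \<le> 1 \<Longrightarrow> 0 < R \<Longrightarrow>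
      w * g powr (p - 2) * u powr (1 - a) * s ^ (4 * m - 2) / R\<^sup>2
      \<le> \<epsilon> * (w * g powr p * u powr (- a - 1) * s ^ (4 * m) + u powr (- \<delta> - a) * s ^ (4 * m))
        + C2 * (w powr k * R powr (- (p * k)))"
    by (rule mixed_term_bound[OF p k(2,1) _ _ \<epsilon> pkN, of 2]) auto
  show thesis
  proof (rule that[of "L * (2 * (C1 + C2))"])
    fix R :: real assume R: "0 < R"
    define s :: "'a \<Rightarrow> real" where "s = cutoff R"
    have s: "0 \<le> s x" "s x \<le> 1" for x by (simp_all add: s_def cutoff_nonneg cutoff_le_1)
    have s0: "s x = 0" if "2 * R \<le> norm x" for x using cutoff_eq_0[OF R that] by (simp add: s_def)
    have sx: "norm x \<le> 2 * R" if "s x \<noteq> 0" for x using s0[of x] that by (meson nle_le)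
    have cs: "continuous_on UNIV s" unfolding s_def by (rule continuous_on_cutoff)
    define P where "P x = w x * norm (G x) powr p * u x powr (- a - 1) * s x ^ (4 * m)" for x
    define X where "X x = u x powr (- \<delta> - a) * s x ^ (4 * m)" for x
    \<comment> \<open>Restricting to the ball loses nothing: outside it \<open>s\<close> is 0 and
      the mixed terms vanish.\<close>
    define B where "B x = (if x \<in> ball 0 (2 * R) then w x powr k else 0) * R powr (- (p * k))" for x
    define IP IX IB where "IP = integral UNIV P" and "IX = integral UNIV X" and "IB = integral UNIV B"
    \<comment> \<open>The integral of one common majorant for both kinds of mixed terms.\<close>
    define Y where "Y = \<epsilon> * (IP + IX) + (C1 + C2) * IB"
    have nn: "0 \<le> P x" "0 \<le> X x" "0 \<le> B x" for x
      using w[of x] u[of x] s[of x] by (simp_all add: P_def X_def B_def)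
    have contu: "continuous_on UNIV (\<lambda>x. u x powr b)" for b
      by (intro continuous_intros cu) (metis u less_irrefl)
    \<comment> \<open>Used with the exponents \<open>p\<close> and \<open>p - 2\<close>; as these
      are positive, continuity holds at critical points of \<open>u\<close> as well.\<close>
    have contg: "continuous_on UNIV (\<lambda>x. norm (G x) powr b)" if "0 < b" for b
      by (rule continuous_on_powr') (use that in \<open>auto intro!: continuous_intros cG\<close>)
    note conts = cw contu contg cs cG
    have iP: "(P has_integral IP) UNIV"
      unfolding IP_def P_def
      by (intro integrable_integral integrable_on_UNIV_continuous_compact_support[where r = "2 * R"]
          continuous_intros conts) (use p m1 s0 in auto)
    have iX: "(X has_integral IX) UNIV"
      unfolding IX_def X_def
      by (intro integrable_integral integrable_on_UNIV_continuous_compact_support[where r = "2 * R"]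
          continuous_intros conts) (use p m1 s0 in auto)
    have iwk: "(\<lambda>x. w x powr k) integrable_on ball 0 (2 * R)"
      by (intro integrable_on_ball_continuous continuous_intros cw) (metis w less_irrefl)
    have iB: "(B has_integral IB) UNIV"
      unfolding IB_def B_def using iwk
      by (intro integrable_integral integrable_on_mult_left)
        (simp only: Henstock_Kurzweil_Integration.integrable_restrict_UNIV)
    have IB: "IB = R powr (- (p * k)) * integral (ball 0 (2 * R)) (\<lambda>x. w x powr k)"
      unfolding IB_def B_def
      by (simp only: integral_mult_left Henstock_Kurzweil_Integration.integral_restrict_UNIV)
        (rule mult.commute)
    have nnI: "0 \<le> IP" "0 \<le> IX" "0 \<le> IB"
      using has_integral_nonneg iP iX iB nn by blast+
    have iY: "((\<lambda>x. \<epsilon> * (P x + X x) + (C1 + C2) * B x) has_integral Y) UNIV"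
      unfolding Y_def by (intro has_integral_add has_integral_mult_right iP iX iB)
    have T1: "w x * norm (G x) powr (p - 1) * u x powr - a * s x ^ (4 * m - 1) / R
      \<le> \<epsilon> * (P x + X x) + (C1 + C2) * B x" for x
    proof (cases "x \<in> ball 0 (2 * R)")
      case True
      have "C1 * B x \<le> (C1 + C2) * B x" using C2(1) nn[of x] by (intro mult_right_mono) auto
      then show ?thesis
        using C1(2)[of "w x" "norm (G x)" "u x" "s x" R] w u s R True by (simp add: P_def X_def B_def)
    next
      case False
      then have "s x = 0" using s0 by simp
      then show ?thesis using m1 \<epsilon> nn[of x] C1(1) C2(1) by (simp add: power_0_left)
    qed
    have T2: "w x * norm (G x) powr (p - 2) * u x powr (1 - a) * s x ^ (4 * m - 2) / R\<^sup>2
      \<le> \<epsilon> * (P x + X x) + (C1 + C2) * B x" for x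
    proof (cases "x \<in> ball 0 (2 * R)")
      case True
      have "C2 * B x \<le> (C1 + C2) * B x" using C1(1) nn[of x] by (intro mult_right_mono) auto
      then show ?thesis
        using C2(2)[of "w x" "norm (G x)" "u x" "s x" R] w u s R True by (simp add: P_def X_def B_def)
    next
      case False
      then have "s x = 0" using s0 by simp
      then show ?thesis using m1 \<epsilon> nn[of x] C1(1) C2(1) by (simp add: power_0_left)
    qed

    have from_weak: "a * IP \<le> IX + 2 * n * Y"
    proof -
      \<comment> \<open>The exponent of the cutoff is \<open>4 * m\<close>, written so that the
        derivative lemma applies with \<open>2 * m\<close> in place of \<open>m\<close>.\<close>
      define \<phi> where "\<phi> x = u x powr - a * s x ^ (2 * (2 * m))" for x
      have g\<phi>: "grad \<phi> x = (- a * u x powr (- a - 1) * s x ^ (4 * m)) *\<^sub>R G x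
        - (2 * m / R\<^sup>2 * u x powr - a * s x ^ (4 * m - 1)) *\<^sub>R x" for x
        using has_derivative_imp_grad_eq[OF has_derivative_powr_cutoff[OF du u m1(2) R, where b = "- a"]]
        unfolding \<phi>_def s_def by simp
      have C: "C1c \<phi>"
        using C1c_powr_cutoff[OF du cG u m1(2) R, where b = "- a"] unfolding \<phi>_def s_def .
      have c\<phi>: "continuous_on UNIV (grad \<phi>)"
        using C C1_continuous_on_grad unfolding C1c_def by blast
      have g0: "grad \<phi> x = 0" if "2 * R \<le> norm x" for x
        using s0[OF that] m1 by (simp add: g\<phi> power_0_left)
      have f\<phi>: "(\<lambda>x. (- (u x powr (- \<delta>))) * \<phi> x) = (\<lambda>x. - X x)"
      proof
        fix x
        have "u x powr - \<delta> * u x powr - a = u x powr (- \<delta> - a)"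
          by (simp add: powr_add[symmetric])
        then show "(- (u x powr (- \<delta>))) * \<phi> x = - X x"
          unfolding \<phi>_def X_def by simp
      qed
      have "integral UNIV (\<lambda>x. w x * norm (G x) powr (p - 2) * (G x \<bullet> grad \<phi> x))
          - integral UNIV (\<lambda>x. (- (u x powr (- \<delta>))) * \<phi> x) = 0"
        using weak C unfolding weak_solution_def gu by blast
      then have eq: "integral UNIV
          (\<lambda>x. w x * norm (G x) powr (p - 2) * (G x \<bullet> grad \<phi> x)) = - IX"
        unfolding f\<phi> IX_def by simp
      have "(\<lambda>x. w x * norm (G x) powr (p - 2) * (G x \<bullet> grad \<phi> x)) integrable_on UNIV"
        by (intro integrable_on_UNIV_continuous_compact_support[where r = "2 * R"]
            continuous_intros conts c\<phi>) (use p g0 in auto)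
      then have "((\<lambda>x. w x * norm (G x) powr (p - 2) * (G x \<bullet> grad \<phi> x)) has_integral - IX) UNIV"
        unfolding eq[symmetric] by (rule integrable_integral)
      moreover have "((\<lambda>x. - a * P x + 2 * n * (\<epsilon> * (P x + X x) + (C1 + C2) * B x))
          has_integral - a * IP + 2 * n * Y) UNIV"
        by (intro has_integral_add has_integral_mult_right iP iY)
      moreover have "w x * norm (G x) powr (p - 2) * (G x \<bullet> grad \<phi> x)
          \<le> - a * P x + 2 * n * (\<epsilon> * (P x + X x) + (C1 + C2) * B x)" for x
        using weak_integrand_le[OF w[of x] u[of x] s(1)[of x] R p sx[of x] m1(1), where g = "G x" and a = a]
          mult_left_mono[OF T1[of x], of "2 * n"] n
        unfolding g\<phi> P_def n_def by simp
      ultimately have "- IX \<le> - a * IP + 2 * n * Y"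
        by (rule has_integral_le)
      then show ?thesis by simp
    qed

    have from_stab: "a * IX \<le> (a - 1)\<^sup>2 * IP + 4 * ((a - 1) * n + n\<^sup>2) * Y"
    proof -
      \<comment> \<open>The exponent is chosen so that \<open>u x powr (- \<delta> - 1)\<close>
        times the square of \<open>\<phi> x\<close> is again \<open>X x\<close>.\<close>
      define \<phi> where "\<phi> x = u x powr ((1 - a) / 2) * s x ^ (2 * m)" for x
      have g\<phi>: "grad \<phi> x = ((1 - a) / 2 * u x powr ((1 - a) / 2 - 1) * s x ^ (2 * m)) *\<^sub>R G x
        - (m / R\<^sup>2 * u x powr ((1 - a) / 2) * s x ^ (2 * m - 1)) *\<^sub>R x" for x
        using has_derivative_imp_grad_eq[OF has_derivative_powr_cutoff[OF du u m1(1) R, where b = "(1 - a) / 2"]]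
        unfolding \<phi>_def s_def .
      have C: "C1c \<phi>"
        using C1c_powr_cutoff[OF du cG u m1(1) R, where b = "(1 - a) / 2"] unfolding \<phi>_def s_def .
      have c\<phi>: "continuous_on UNIV (grad \<phi>)"
        using C C1_continuous_on_grad unfolding C1c_def by blast
      have g0: "grad \<phi> x = 0" if "2 * R \<le> norm x" for x
        using s0[OF that] m1 by (simp add: g\<phi> power_0_left)
      define D where "D x = w x * norm (G x) powr (p - 2) * (norm (grad \<phi> x))\<^sup>2" for x
      define E where "E x = w x * norm (G x) powr (p - 4) * (G x \<bullet> grad \<phi> x)\<^sup>2" for x
      have f\<phi>: "(\<lambda>x. \<delta> * u x powr (- \<delta> - 1) * (\<phi> x)\<^sup>2) = (\<lambda>x. \<delta> * X x)"
      proof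
        fix x
        have "u x powr (- \<delta> - 1) * (u x powr ((1 - a) / 2))\<^sup>2 = u x powr (- \<delta> - a)"
          unfolding power2_eq_square powr_add[symmetric] by simp
        moreover have "(s x ^ (2 * m))\<^sup>2 = s x ^ (4 * m)"
          by (simp add: power_mult[symmetric])
        ultimately show "\<delta> * u x powr (- \<delta> - 1) * (\<phi> x)\<^sup>2 = \<delta> * X x"
          unfolding \<phi>_def X_def power_mult_distrib by (metis mult.assoc)
      qed
      have "0 \<le> integral UNIV D + (p - 2) * integral UNIV E
          - integral UNIV (\<lambda>x. \<delta> * u x powr (- \<delta> - 1) * (\<phi> x)\<^sup>2)"
        using stab C unfolding stable_def gu D_def E_def by blast
      then have st: "\<delta> * IX \<le> integral UNIV D + (p - 2) * integral UNIV E"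
        unfolding f\<phi> IX_def by simp
      have iD: "D integrable_on UNIV"
        unfolding D_def
        by (intro integrable_on_UNIV_continuous_compact_support[where r = "2 * R"]
            continuous_intros conts c\<phi>) (use p g0 in auto)
      have Dnn: "0 \<le> D x" for x using w[of x] by (simp add: D_def)
      \<comment> \<open>Cauchy-Schwarz; at a critical point of \<open>u\<close> both sides are 0.
        The two gradient integrals in the stability condition then amount to at most
        \<open>1 + (p - 2) = p - 1\<close> copies of the first.\<close>
      have ED: "E x \<le> D x" for x
      proof (cases "G x = 0")
        case True
        then show ?thesis by (simp add: D_def E_def)
      next
        case False
        have "(G x \<bullet> grad \<phi> x)\<^sup>2 \<le> (norm (G x))\<^sup>2 * (norm (grad \<phi> x))\<^sup>2"
          using Cauchy_Schwarz_ineq[of "G x" "grad \<phi> x"] by (simp add: power2_norm_eq_inner)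
        then have "E x \<le> w x * norm (G x) powr (p - 4) * ((norm (G x))\<^sup>2 * (norm (grad \<phi> x))\<^sup>2)"
          unfolding E_def using w[of x] by (intro mult_left_mono) auto
        also have "\<dots> = D x"
        proof -
          have "norm (G x) powr (p - 4) * (norm (G x))\<^sup>2 = norm (G x) powr (p - 2)"
            using False powr_add[of "norm (G x)" "p - 4" 2] by simp
          then show ?thesis unfolding D_def by (metis mult.assoc)
        qed
        finally show ?thesis .
      qed
      text \<open>For p < 4 continuity of E at critical points is not needed: if E is not integrable, its
        integral is 0 by convention.\<close>
      have "integral UNIV E \<le> integral UNIV D"
      proof (cases "E integrable_on UNIV")
        case True
        then show ?thesis using iD ED by (intro integral_le) auto
      next
        case False
        then show ?thesis using iD Dnn by (simp add: not_integrable_integral integral_nonneg)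
      qed
      then have "\<delta> * IX \<le> (p - 1) * integral UNIV D"
        using st p mult_left_mono[of "integral UNIV E" "integral UNIV D" "p - 2"]
        by (simp add: algebra_simps)
      \<comment> \<open>Through \<open>4 * \<delta> = a * (p - 1)\<close> the factor
        \<open>p - 1\<close> cancels from both sides.\<close>
      moreover have "(p - 1) * (a * IX) = 4 * (\<delta> * IX)"
        unfolding mult.assoc[symmetric] a\<delta> by (simp add: mult.commute)
      ultimately have "(p - 1) * (a * IX) \<le> (p - 1) * (4 * integral UNIV D)" by linarith
      then have "a * IX \<le> 4 * integral UNIV D" using p by simp
      moreover have "integral UNIV D \<le> (a - 1)\<^sup>2 / 4 * IP + ((a - 1) * n + n\<^sup>2) * Y"
      proof (rule has_integral_le)
        show "(D has_integral integral UNIV D) UNIV" using iD by (rule integrable_integral)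
        show "((\<lambda>x. (a - 1)\<^sup>2 / 4 * P x + ((a - 1) * n + n\<^sup>2) * (\<epsilon> * (P x + X x) + (C1 + C2) * B x))
          has_integral (a - 1)\<^sup>2 / 4 * IP + ((a - 1) * n + n\<^sup>2) * Y) UNIV"
          by (intro has_integral_add has_integral_mult_right iP iY)
        have n1: "0 \<le> (a - 1) * n" using n a by simp
        show "D x \<le> (a - 1)\<^sup>2 / 4 * P x + ((a - 1) * n + n\<^sup>2) * (\<epsilon> * (P x + X x) + (C1 + C2) * B x)" for x
          using stable_integrand_le[OF w[of x] u[of x] s(1)[of x] R p a sx[of x] m1(1), where g = "G x"]
            mult_left_mono[OF T1[of x] n1] mult_left_mono[OF T2[of x] zero_le_power2[of n]]
          unfolding D_def g\<phi> P_def[symmetric] n_def[symmetric] distrib_right[of "(a - 1) * n"] by linarith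
      qed
      ultimately show ?thesis by (simp add: algebra_simps)
    qed

    \<comment> \<open>Multiply the stability bound by \<open>a\<close> and insert the bound for
      \<open>a * IP\<close> from the equation. What remains on the left is a^2 - (a-1)^2 = 2a - 1,
      which is at least 1.\<close>
    have "a * (a * IX) \<le> (a - 1)\<^sup>2 * (a * IP) + 4 * ((a - 1) * n + n\<^sup>2) * a * Y"
      using mult_left_mono[OF from_stab, of a] a by (simp add: algebra_simps)
    also have "\<dots> \<le> (a - 1)\<^sup>2 * (IX + 2 * n * Y) + 4 * ((a - 1) * n + n\<^sup>2) * a * Y"
      using from_weak by (intro add_right_mono mult_left_mono) auto
    finally have "(2 * a - 1) * IX \<le> L * Y"
      unfolding L_def by (simp add: algebra_simps power2_eq_square)
    moreover have "1 * IX \<le> (2 * a - 1) * IX" using a nnI by (intro mult_right_mono) auto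
    ultimately have IX: "IX \<le> L * Y" by simp
    \<comment> \<open>Absorption: \<open>IP + IX\<close> is controlled by \<open>Y\<close>, which
      itself contains \<open>\<epsilon> * (IP + IX)\<close>. By the choice of
      \<open>\<epsilon>\<close> that share is at most \<open>Y / 2\<close>, so \<open>Y\<close> is
      controlled by \<open>IB\<close> alone.\<close>
    have "1 * IP \<le> a * IP" using a nnI by (intro mult_right_mono) auto
    then have "IP + IX \<le> (2 * L + 2 * n) * Y" using from_weak IX by (simp add: algebra_simps)
    then have "\<epsilon> * (IP + IX) \<le> \<epsilon> * ((2 * L + 2 * n) * Y)" using \<epsilon> by (intro mult_left_mono) auto
    also have "\<dots> = Y / 2" using n L by (simp add: \<epsilon>_def field_simps)
    finally have "Y \<le> 2 * ((C1 + C2) * IB)" by (simp add: Y_def mult.commute)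
    then have "IX \<le> L * (2 * ((C1 + C2) * IB))"
      using IX L mult_left_mono order_trans by blast
    then show "integral UNIV (\<lambda>x. u x powr (- \<delta> - a) * cutoff R x ^ (4 * m))
      \<le> L * (2 * (C1 + C2)) * (R powr (- (p * k)) * integral (ball 0 (2 * R)) (\<lambda>x. w x powr k))"
      unfolding IX_def X_def s_def IB by (simp only: mult.assoc)
  qed
qed

section \<open>Letting the radius tend to infinity\<close>

theorem theorem3:
  fixes w :: "'a::euclidean_space \<Rightarrow> real" and p \<delta> C \<tau> \<zeta> :: real
  assumes "p > 2"
    and "\<delta> \<ge> max 1 ((p - 1)\<^sup>2 / 4)"
    and "C1 w" and "C > 0" and "\<forall>x. w x > 0" and "\<forall>x. w x > C"
    and "(\<lambda>R. integral (ball 0 (2 * R)) (\<lambda>x. w x powr exp_k p \<delta>)) \<in> O[at_top](\<lambda>R. R powr \<tau>)"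
    and "0 < \<tau>" and "\<tau> < p * exp_k p \<delta>"
    and "0 < \<zeta>" and "\<zeta> < 1"
  shows "\<not> (\<exists>u. (\<forall>x. u x > 0) \<and> C1_holder_loc \<zeta> u \<and> weak_solution w p \<delta> u \<and> stable w p \<delta> u)"
proof
  assume "\<exists>u. (\<forall>x. u x > 0) \<and> C1_holder_loc \<zeta> u \<and> weak_solution w p \<delta> u \<and> stable w p \<delta> u"
  then obtain u where u: "\<And>x. 0 < u x" and hol: "C1_holder_loc \<zeta> u"
    and weak: "weak_solution w p \<delta> u" and stab: "stable w p \<delta> u" by blast
  obtain G where du: "\<And>x. (u has_derivative (\<lambda>h. G x \<bullet> h)) (at x)" and cG: "continuous_on UNIV G"
    using hol unfolding C1_holder_loc_def by blast
  have cu: "continuous_on UNIV u"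
    using du by (meson continuous_at_imp_continuous_on has_derivative_continuous)
  have cw: "continuous_on UNIV w"
    using \<open>C1 w\<close> unfolding C1_def
    by (meson continuous_at_imp_continuous_on has_derivative_continuous)
  have w: "\<And>x. 0 < w x" using assms(5) by blast
  \<comment> \<open>In terms of \<open>a\<close>, \<open>2 * exp_l p \<delta> = a - (p - 1)\<close>,
    which gives \<open>k\<close> the form required by the energy estimate. The lower bound on
    \<open>\<delta>\<close> by (p-1)^2/4 says that \<open>a \<ge> p - 1\<close>; this yields
    \<open>1 \<le> k\<close> and, as \<open>p > 2\<close>, also \<open>1 \<le> a\<close>.\<close>
  define a where "a = 4 * \<delta> / (p - 1)"
  define k where "k = exp_k p \<delta>"
  have \<delta>: "1 \<le> \<delta>" "(p - 1)\<^sup>2 \<le> 4 * \<delta>" using assms(2) by auto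
  have a: "p - 1 \<le> a" using \<delta>(2) \<open>2 < p\<close> by (simp add: a_def field_simps power2_eq_square)
  have a\<delta>: "4 * \<delta> = a * (p - 1)" using \<open>2 < p\<close> by (simp add: a_def)
  have "2 * exp_l p \<delta> = a - (p - 1)" by (simp add: exp_l_def a_def field_simps)
  then have "k = (\<delta> + a) / (\<delta> + p - 1)" by (simp add: k_def exp_k_def algebra_simps)
  then have k: "\<delta> + a = (\<delta> + p - 1) * k" "1 \<le> k"
    using \<open>2 < p\<close> \<delta> a by auto
  obtain m :: nat where "p * k \<le> m" using real_arch_simple by blast
  then have m: "p * k \<le> 4 * m" by simp
  have a1: "1 \<le> a" using a \<open>2 < p\<close> by simp
  obtain K where K: "\<And>R. 0 < R \<Longrightarrow>
    integral UNIV (\<lambda>x. u x powr (- \<delta> - a) * cutoff R x ^ (4 * m))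
    \<le> K * (R powr (- (p * k)) * integral (ball 0 (2 * R)) (\<lambda>x. w x powr k))"
    using energy_estimate[OF \<open>2 < p\<close> a1 a\<delta> k m cw w u du cG weak stab] by blast
  define I where "I R = integral UNIV (\<lambda>x. u x powr (- \<delta> - a) * cutoff R x ^ (4 * m))" for R
  have "0 < p * k" using k(2) \<open>2 < p\<close> by simp
  then have "m \<noteq> 0" using m by (intro notI) simp
  have cX: "continuous_on UNIV (\<lambda>x. u x powr (- \<delta> - a) * cutoff R x ^ (4 * m))" for R
    by (intro continuous_intros cu) (metis u less_irrefl)
  have iX: "(\<lambda>x. u x powr (- \<delta> - a) * cutoff R x ^ (4 * m)) integrable_on UNIV" if "0 < R" for R
    by (rule integrable_on_UNIV_continuous_compact_support[OF cX, of "2 * R"])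
      (use cutoff_eq_0[OF that] \<open>m \<noteq> 0\<close> in auto)
  \<comment> \<open>The integrand is positive at the origin, where the cutoff equals 1.\<close>
  have I1: "0 < I 1"
    unfolding I_def
    by (rule integral_UNIV_pos_continuous[OF cX iX, where z = 0])
      (use u in \<open>auto simp: cutoff_nonneg\<close>, auto simp: cutoff_def u less_imp_neq[symmetric])
  \<comment> \<open>The cutoffs increase pointwise with the radius, so \<open>I 1\<close> is a fixed
    positive lower bound.\<close>
  have mono: "I 1 \<le> I R" if "1 \<le> R" for R
    unfolding I_def
    by (rule integral_le)
      (use that iX u in \<open>auto intro!: mult_left_mono power_mono cutoff_mono cutoff_nonneg\<close>)
  obtain c where c: "\<forall>\<^sub>F R in at_top.
      norm (integral (ball 0 (2 * R)) (\<lambda>x. w x powr k)) \<le> c * norm (R powr \<tau>)"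
    using landau_o.bigE[OF assms(7)] unfolding k_def by blast
  have "\<forall>\<^sub>F R in at_top. I 1 \<le> \<bar>K\<bar> * c * R powr (\<tau> - p * k)"
    using c eventually_ge_at_top[of 1]
  proof eventually_elim
    case (elim R)
    have "I 1 \<le> K * (R powr (- (p * k)) * integral (ball 0 (2 * R)) (\<lambda>x. w x powr k))"
      using mono[OF elim(2)] K[of R] elim(2) by (simp add: I_def)
    also have "\<dots> \<le> \<bar>K\<bar> * (R powr (- (p * k)) * norm (integral (ball 0 (2 * R)) (\<lambda>x. w x powr k)))"
      by (rule order_trans[OF abs_ge_self]) (simp add: abs_mult)
    also have "\<dots> \<le> \<bar>K\<bar> * (R powr (- (p * k)) * (c * R powr \<tau>))"
      using elim(1) by (intro mult_left_mono) auto
    also have "\<dots> = \<bar>K\<bar> * c * (R powr \<tau> * R powr (- (p * k)))" by simp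
    also have "\<dots> = \<bar>K\<bar> * c * R powr (\<tau> - p * k)" by (simp only: powr_add[symmetric]) simp
    finally show ?case .
  qed
  \<comment> \<open>The exponent \<open>\<tau> - p * k\<close> is negative, so the upper bound for
    the constant \<open>I 1\<close> tends to 0.\<close>
  moreover have "((\<lambda>R. \<bar>K\<bar> * c * R powr (\<tau> - p * k)) \<longlongrightarrow> \<bar>K\<bar> * c * 0) at_top"
    using assms(9) unfolding k_def by (intro tendsto_intros tendsto_neg_powr filterlim_ident) simp
  ultimately have "I 1 \<le> \<bar>K\<bar> * c * 0"
    by (intro tendsto_lowerbound) auto
  with I1 show False by simp
qed

end
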